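(* Let $d$ and $n$ be positive integers, and let $\delta \ge \pi-p_{n+1}(\mathbb{R}P^d)$. Then there is a continuous odd map $S^n \to S^d_\delta$.
   Context: $S^d\subset\mathbb{R}^{d+1}$ is the unit sphere with the geodesic (angular) metric $d(x,y)=\arccos\langle x,y\rangle$ and the antipodal involution $x\mapsto -x$. $\mathbb{R}P^d=S^d/(x\sim -x)$ carries the quotient metric: the distance between two points is the angle in $[0,\pi/2]$ between the corresponding lines. For a compact metric space $(X,d)$ and $m\ge 1$, $p_m(X)=\sup\{\varepsilon>0 : \text{there are } x_1,\dots,x_m\in X \text{ with } d(x_i,x_j)\ge\varepsilon \text{ for all } i\ne j\}$. For a metric space $X$ and $\delta\ge 0$, the (Vietoris--Rips) metric thickening $X_\delta$ is the set of probability measures $\mu=\sum_i\lambda_i x_i$ on $X$ (finite convex combinations of Dirac measures, each point being identified with its Dirac measure) whose support is finite and has diameter at most $\delta$, equipped with the $1$-Wasserstein metric. The involution on $S^d$ induces the involution $\sum_i\lambda_i x_i\mapsto\sum_i\lambda_i(-x_i)$ on $S^d_\delta$. A map between spaces with involutions is odd if it commutes with the involutions. *)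

theory Defs
  imports "HOL-Probability.Probability"
begin

section \<open>The sphere with its geodesic metric\<close>

text \<open>The type \<open>'a metric\<close> of the library requires a distance function that is nonnegative and
  symmetric on the whole type, while \<^const>\<open>arccos\<close> is unspecified outside \<open>[-1, 1]\<close>. Hence the
  default value \<open>0\<close> off the sphere here, and off the quotient in \<open>proj_dist\<close> below.\<close>

definition sphere_dist :: "'a::real_inner \<Rightarrow> 'a \<Rightarrow> real" where
  "sphere_dist x y = (if x \<in> sphere 0 1 \<and> y \<in> sphere 0 1 then arccos (x \<bullet> y) else 0)"

definition sphere_metric :: "'a::real_inner metric" where
  "sphere_metric = metric (sphere 0 1, sphere_dist)"

lemma abs_inner_sphere_le_1:
  fixes x y :: "'a::real_inner"
  assumes "x \<in> sphere 0 1" "y \<in> sphere 0 1"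
  shows "\<bar>x \<bullet> y\<bar> \<le> 1"
  using Cauchy_Schwarz_ineq2[of x y] assms by simp

lemma arccos_inner_triangle:
  fixes x y z :: "'a::real_inner"
  assumes "x \<in> sphere 0 1" "y \<in> sphere 0 1" "z \<in> sphere 0 1"
  shows "arccos (x \<bullet> z) \<le> arccos (x \<bullet> y) + arccos (y \<bullet> z)"
proof -
  define p q where "p = x \<bullet> y" and "q = y \<bullet> z"
  have p: "-1 \<le> p" "p \<le> 1" and q: "-1 \<le> q" "q \<le> 1"
    using abs_inner_sphere_le_1[OF assms(1,2)] abs_inner_sphere_le_1[OF assms(2,3)]
    by (auto simp: p_def q_def abs_le_iff)
  have r: "\<bar>x \<bullet> z\<bar> \<le> 1"
    using abs_inner_sphere_le_1[OF assms(1,3)] .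
  have xx: "x \<bullet> x = 1" "y \<bullet> y = 1" "z \<bullet> z = 1"
    using assms by (auto simp: dot_square_norm)
  have n1: "norm (x - p *\<^sub>R y) = sqrt (1 - p\<^sup>2)"
    by (simp add: norm_eq_sqrt_inner inner_diff_left inner_diff_right xx p_def inner_commute
        power2_eq_square)
  have n2: "norm (z - q *\<^sub>R y) = sqrt (1 - q\<^sup>2)"
    by (simp add: norm_eq_sqrt_inner inner_diff_left inner_diff_right xx q_def inner_commute
        power2_eq_square)
  have ip: "(x - p *\<^sub>R y) \<bullet> (z - q *\<^sub>R y) = x \<bullet> z - p * q"
    by (simp add: inner_diff_left inner_diff_right xx p_def q_def inner_commute)
  have "p * q - sqrt (1 - p\<^sup>2) * sqrt (1 - q\<^sup>2) \<le> x \<bullet> z"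
    using Cauchy_Schwarz_ineq2[of "x - p *\<^sub>R y" "z - q *\<^sub>R y"] unfolding n1 n2 ip
    by (simp add: abs_le_iff)
  moreover have "cos (arccos p + arccos q) = p * q - sqrt (1 - p\<^sup>2) * sqrt (1 - q\<^sup>2)"
    using p q by (simp add: cos_add sin_arccos)
  ultimately have *: "cos (arccos p + arccos q) \<le> x \<bullet> z"
    by simp
  have bp: "0 \<le> arccos p" "0 \<le> arccos q"
    using p q by (auto intro: arccos_lbound)
  show ?thesis
  proof (cases "arccos p + arccos q \<le> pi")
    case True
    have "arccos (x \<bullet> z) \<le> arccos (cos (arccos p + arccos q))"
      using * r by (intro arccos_le_arccos) auto
    also have "\<dots> = arccos p + arccos q"
      using True bp by (intro arccos_cos) auto
    finally show ?thesis by (simp add: p_def q_def)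
  next
    case False
    moreover have "arccos (x \<bullet> z) \<le> pi"
      using r by (auto intro: arccos_ubound)
    ultimately show ?thesis by (simp add: p_def q_def)
  qed
qed

interpretation sphere: Metric_space "sphere (0::'a::real_inner) 1" sphere_dist
proof
  fix x y z :: 'a
  show "0 \<le> sphere_dist x y"
    using abs_inner_sphere_le_1[of x y] by (auto simp: sphere_dist_def abs_le_iff intro!: arccos_lbound)
  show "sphere_dist x y = sphere_dist y x"
    by (auto simp: sphere_dist_def inner_commute)
  assume xy: "x \<in> sphere 0 1" "y \<in> sphere 0 1"
  show "sphere_dist x y = 0 \<longleftrightarrow> x = y"
  proof
    assume "sphere_dist x y = 0"
    then have "arccos (x \<bullet> y) = 0" using xy by (simp add: sphere_dist_def)
    then have "x \<bullet> y = 1"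
      using abs_inner_sphere_le_1[OF xy] cos_arccos_abs cos_zero by metis
    moreover have "(x - y) \<bullet> (x - y) = x \<bullet> x - 2 * (x \<bullet> y) + y \<bullet> y"
      by (simp add: inner_diff_left inner_diff_right inner_commute)
    moreover have "x \<bullet> x = 1" "y \<bullet> y = 1"
      using xy by (simp_all add: dot_square_norm)
    ultimately have "(x - y) \<bullet> (x - y) = 0" by linarith
    then show "x = y" by simp
  next
    assume "x = y"
    then show "sphere_dist x y = 0"
      using xy by (simp add: sphere_dist_def dot_square_norm)
  qed
  assume "z \<in> sphere 0 1"
  then show "sphere_dist x z \<le> sphere_dist x y + sphere_dist y z"
    using xy arccos_inner_triangle[of x y z] by (simp add: sphere_dist_def)
qed

lemma mspace_sphere_metric [simp]: "mspace (sphere_metric :: 'a::real_inner metric) = sphere 0 1"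
  by (simp add: sphere_metric_def)

lemma mdist_sphere_metric [simp]: "mdist (sphere_metric :: 'a::real_inner metric) = sphere_dist"
  by (simp add: sphere_metric_def)

lemma sphere_dist_uminus [simp]: "sphere_dist (- x) (- y) = sphere_dist x y"
  by (simp add: sphere_dist_def)

lemma mtopology_of_sphere_metric:
  "mtopology_of (sphere_metric :: 'a::real_inner metric) = top_of_set (sphere 0 1)"
proof -
  have inner_cos: "x \<bullet> y = cos (sphere_dist x y)"
    if "x \<in> sphere 0 1" "y \<in> sphere 0 1" for x y :: 'a
    using that abs_inner_sphere_le_1[OF that] by (simp add: sphere_dist_def cos_arccos_abs)
  have dist_cos: "dist x y = sqrt (2 - 2 * cos (sphere_dist x y))"
    if "x \<in> sphere 0 1" "y \<in> sphere 0 1" for x y :: 'a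
  proof -
    have "x \<bullet> x = 1" "y \<bullet> y = 1"
      using that by (simp_all add: dot_square_norm)
    moreover have "(x - y) \<bullet> (x - y) = x \<bullet> x - 2 * (x \<bullet> y) + y \<bullet> y"
      by (simp add: inner_diff_left inner_diff_right inner_commute)
    ultimately have "(x - y) \<bullet> (x - y) = 2 - 2 * cos (sphere_dist x y)"
      using inner_cos[OF that] by linarith
    then show ?thesis by (simp only: dist_norm norm_eq_sqrt_inner)
  qed
  have "openin sphere.mtopology U \<longleftrightarrow> openin (top_of_set (sphere 0 1)) U" for U :: "'a set"
  proof
    assume U: "openin sphere.mtopology U"
    show "openin (top_of_set (sphere 0 1)) U"
      unfolding openin_euclidean_subtopology_iff
    proof (intro conjI ballI)
      show sub: "U \<subseteq> sphere 0 1"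
        using U by (simp add: sphere.openin_mtopology)
      fix x assume x: "x \<in> U"
      then have xs: "x \<in> sphere 0 1" using sub by blast
      obtain r where r: "r > 0" "sphere.mball x r \<subseteq> U"
        using U x by (auto simp: sphere.openin_mtopology)
      have "((\<lambda>y. arccos (x \<bullet> y)) \<longlongrightarrow> arccos (x \<bullet> x)) (at x within sphere 0 1)"
      proof -
        have "continuous_on (sphere 0 1) (\<lambda>y. arccos (x \<bullet> y))"
        proof (rule continuous_on_arccos)
          show "\<forall>y\<in>sphere 0 1. -1 \<le> x \<bullet> y \<and> x \<bullet> y \<le> 1"
            using abs_inner_sphere_le_1[OF xs] by (metis abs_le_iff minus_le_iff)
        qed (intro continuous_intros)
        then show ?thesis using xs by (simp add: continuous_on_def)
      qed
      moreover have "arccos (x \<bullet> x) < r" using xs r by (simp add: dot_square_norm)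
      ultimately have "\<forall>\<^sub>F y in at x within sphere 0 1. arccos (x \<bullet> y) < r"
        by (rule order_tendstoD(2))
      then obtain e where e: "e > 0"
        "\<And>y. y \<in> sphere 0 1 \<Longrightarrow> y \<noteq> x \<Longrightarrow> dist y x < e \<Longrightarrow> arccos (x \<bullet> y) < r"
        by (auto simp: eventually_at)
      have "y \<in> U" if y: "y \<in> sphere 0 1" "dist y x < e" for y
      proof (cases "y = x")
        case False
        then have "arccos (x \<bullet> y) < r" using e y by blast
        then have "y \<in> sphere.mball x r"
          using xs y by (simp add: sphere_dist_def)
        then show ?thesis using r by blast
      qed (use x in simp)
      then show "\<exists>e>0. \<forall>x'\<in>sphere 0 1. dist x' x < e \<longrightarrow> x' \<in> U"
        using e(1) by blast
    qed
  next
    assume U: "openin (top_of_set (sphere 0 1)) U"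
    show "openin sphere.mtopology U"
      unfolding sphere.openin_mtopology
    proof (intro conjI allI impI)
      show sub: "U \<subseteq> sphere 0 1"
        using U by (simp add: openin_euclidean_subtopology_iff)
      fix x assume x: "x \<in> U"
      then have xs: "x \<in> sphere 0 1" using sub by blast
      obtain e where e: "e > 0" "\<And>y. y \<in> sphere 0 1 \<Longrightarrow> dist y x < e \<Longrightarrow> y \<in> U"
        using U x unfolding openin_euclidean_subtopology_iff by blast
      have "((\<lambda>t. sqrt (2 - 2 * cos t)) \<longlongrightarrow> sqrt (2 - 2 * cos 0)) (at (0::real))"
        by (intro tendsto_intros)
      then have "\<forall>\<^sub>F t in at (0::real). sqrt (2 - 2 * cos t) < e"
        by (rule order_tendstoD(2)) (use e in simp)
      then obtain r where r: "r > 0"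
        "\<And>t::real. t \<noteq> 0 \<Longrightarrow> \<bar>t\<bar> < r \<Longrightarrow> sqrt (2 - 2 * cos t) < e"
        by (auto simp: eventually_at)
      have "sphere.mball x r \<subseteq> U"
      proof
        fix y assume "y \<in> sphere.mball x r"
        then have ys: "y \<in> sphere 0 1" and lt: "sphere_dist x y < r" by auto
        have "dist x y < e"
        proof (cases "sphere_dist x y = 0")
          case True
          then show ?thesis using dist_cos[OF xs ys] e by simp
        next
          case False
          then show ?thesis using r lt dist_cos[OF xs ys] by simp
        qed
        then show "y \<in> U" using e ys by (simp add: dist_commute)
      qed
      then show "\<exists>r>0. sphere.mball x r \<subseteq> U" using r by blast
    qed
  qed
  then show ?thesis by (simp add: sphere_metric_def topology_eq)
qed


section \<open>Real projective space\<close>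

definition antipodal :: "('a::real_inner \<times> 'a) set" where
  "antipodal = {(x, y). x \<in> sphere 0 1 \<and> (y = x \<or> y = - x)}"

definition proj_space :: "'a::real_inner set set" where
  "proj_space = sphere 0 1 // antipodal"

definition proj_dist :: "'a::real_inner set \<Rightarrow> 'a set \<Rightarrow> real" where
  "proj_dist p q = (if p \<in> proj_space \<and> q \<in> proj_space
     then (INF (x, y) \<in> p \<times> q. sphere_dist x y) else 0)"

definition proj_metric :: "'a::real_inner set metric" where
  "proj_metric = metric (proj_space, proj_dist)"

lemma equiv_antipodal: "equiv (sphere 0 1) (antipodal :: ('a::real_inner \<times> 'a) set)"
  by (rule equivI) (auto simp: antipodal_def refl_on_def sym_def trans_def)

lemma proj_space_eq: "proj_space = (\<lambda>x::'a::real_inner. {x, - x}) ` sphere 0 1"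
  by (auto simp: proj_space_def quotient_def antipodal_def)

lemma proj_spaceE:
  assumes "p \<in> proj_space"
  obtains x :: "'a::real_inner" where "x \<in> sphere 0 1" "p = {x, - x}"
  using assms by (auto simp: proj_space_eq)

lemma proj_dist_eq_min:
  fixes x y :: "'a::real_inner"
  assumes "x \<in> sphere 0 1" "y \<in> sphere 0 1"
  shows "proj_dist {x, - x} {y, - y} = min (sphere_dist x y) (sphere_dist x (- y))"
proof -
  have "{x, - x} \<in> proj_space" "{y, - y} \<in> proj_space"
    using assms by (auto simp: proj_space_eq)
  moreover have "(\<lambda>(x, y). sphere_dist x y) ` ({x, - x} \<times> {y, - y})
      = {sphere_dist x y, sphere_dist x (- y)}"
    using sphere_dist_uminus[of x y] sphere_dist_uminus[of x "- y"]
    by (auto simp: image_iff)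
  ultimately show ?thesis
    by (simp add: proj_dist_def cInf_insert_If inf_min)
qed

lemma proj_dist_eq_angle:
  fixes x y :: "'a::real_inner"
  assumes "x \<in> sphere 0 1" "y \<in> sphere 0 1"
  shows "proj_dist {x, - x} {y, - y} = arccos \<bar>x \<bullet> y\<bar>"
proof -
  have "-1 \<le> x \<bullet> y" "x \<bullet> y \<le> 1"
    using abs_inner_sphere_le_1[OF assms] by (auto simp: abs_le_iff)
  then have "arccos (x \<bullet> y) \<le> arccos (- (x \<bullet> y)) \<longleftrightarrow> 0 \<le> x \<bullet> y"
    by (subst arccos_le_mono) (auto simp: abs_le_iff)
  then show ?thesis
    unfolding proj_dist_eq_min[OF assms] using assms
    by (auto simp: sphere_dist_def min_def abs_if)
qed

interpretation proj: Metric_space "proj_space :: 'a::real_inner set set" proj_dist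
proof
  fix p q r :: "'a set"
  show "0 \<le> proj_dist p q"
  proof (cases "p \<in> proj_space \<and> q \<in> proj_space")
    case True
    then show ?thesis
      by (metis proj_spaceE proj_dist_eq_min sphere.nonneg min_def)
  qed (auto simp: proj_dist_def)
  show "proj_dist p q = proj_dist q p"
  proof (cases "p \<in> proj_space \<and> q \<in> proj_space")
    case True
    then show ?thesis
      by (metis proj_spaceE proj_dist_eq_angle inner_commute)
  qed (auto simp: proj_dist_def)
  assume p: "p \<in> proj_space" and q: "q \<in> proj_space"
  obtain x where x: "x \<in> sphere 0 1" "p = {x, - x}" using p by (rule proj_spaceE)
  obtain y where y: "y \<in> sphere 0 1" "q = {y, - y}" using q by (rule proj_spaceE)
  have my: "- y \<in> sphere 0 1" using y by simp
  show "proj_dist p q = 0 \<longleftrightarrow> p = q"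
  proof
    assume "proj_dist p q = 0"
    then have "sphere_dist x y = 0 \<or> sphere_dist x (- y) = 0"
      using x y by (auto simp: proj_dist_eq_min min_def split: if_splits)
    then have "x = y \<or> x = - y"
      using x y my sphere.zero by blast
    then show "p = q" using x y by auto
  next
    assume "p = q"
    then have "y = x \<or> y = - x" using x y by (auto simp: doubleton_eq_iff)
    then show "proj_dist p q = 0"
      using x y my sphere.zero sphere.nonneg
      by (auto simp: proj_dist_eq_angle dot_square_norm)
  qed
  assume r: "r \<in> proj_space"
  obtain z where z: "z \<in> sphere 0 1" "r = {z, - z}" using r by (rule proj_spaceE)
  have mz: "- z \<in> sphere 0 1" using z by simp
  have "sphere_dist x z \<le> sphere_dist x y + sphere_dist y z"
    "sphere_dist x z \<le> sphere_dist x (- y) + sphere_dist (- y) z"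
    "sphere_dist x (- z) \<le> sphere_dist x y + sphere_dist y (- z)"
    "sphere_dist x (- z) \<le> sphere_dist x (- y) + sphere_dist (- y) (- z)"
    using x(1) y(1) z(1) my mz by (blast intro: sphere.triangle)+
  moreover have "sphere_dist (- y) z = sphere_dist y (- z)"
    using sphere_dist_uminus[of y "- z"] by simp
  ultimately show "proj_dist p r \<le> proj_dist p q + proj_dist q r"
    unfolding x(2) y(2) z(2) proj_dist_eq_min[OF x(1) y(1)] proj_dist_eq_min[OF y(1) z(1)]
      proj_dist_eq_min[OF x(1) z(1)]
    by (auto simp: min_def)
qed

lemma mspace_proj_metric [simp]: "mspace proj_metric = proj_space"
  by (simp add: proj_metric_def)

lemma mdist_proj_metric [simp]: "mdist proj_metric = proj_dist"
  by (simp add: proj_metric_def)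


section \<open>Separation of \<open>m\<close> points\<close>

definition max_separation :: "nat \<Rightarrow> 'a metric \<Rightarrow> real" where
  "max_separation m X = Sup {\<epsilon>. 0 < \<epsilon> \<and> (\<exists>x :: nat \<Rightarrow> 'a. (\<forall>i<m. x i \<in> mspace X) \<and>
     (\<forall>i<m. \<forall>j<m. i \<noteq> j \<longrightarrow> \<epsilon> \<le> mdist X (x i) (x j)))}"


section \<open>Metric thickenings\<close>

text \<open>Finitely supported probability measures are modelled by \<^typ>\<open>'a pmf\<close>, with \<^const>\<open>return_pmf\<close>
  as the Dirac measures. A coupling of two of them is again finitely supported, so it is
  a \<^const>\<open>pmf\<close> as well.\<close>

definition couplings :: "'a pmf \<Rightarrow> 'a pmf \<Rightarrow> ('a \<times> 'a) pmf set" where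
  "couplings \<mu> \<nu> = {\<pi>. map_pmf fst \<pi> = \<mu> \<and> map_pmf snd \<pi> = \<nu>}"

definition wasserstein1 :: "'a metric \<Rightarrow> 'a pmf \<Rightarrow> 'a pmf \<Rightarrow> real" where
  "wasserstein1 X \<mu> \<nu> =
     (INF \<pi> \<in> couplings \<mu> \<nu>. measure_pmf.expectation \<pi> (\<lambda>(x, y). mdist X x y))"

definition thickening_space :: "'a metric \<Rightarrow> real \<Rightarrow> 'a pmf set" where
  "thickening_space X \<delta> = {\<mu>. finite (set_pmf \<mu>) \<and> set_pmf \<mu> \<subseteq> mspace X \<and>
     (\<forall>x \<in> set_pmf \<mu>. \<forall>y \<in> set_pmf \<mu>. mdist X x y \<le> \<delta>)}"

definition metric_thickening :: "'a metric \<Rightarrow> real \<Rightarrow> 'a pmf metric" where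
  "metric_thickening X \<delta> = metric (thickening_space X \<delta>, wasserstein1 X)"

lemma pair_pmf_in_couplings: "pair_pmf \<mu> \<nu> \<in> couplings \<mu> \<nu>"
  by (simp add: couplings_def map_fst_pair_pmf map_snd_pair_pmf)

lemma set_pmf_coupling:
  assumes "\<pi> \<in> couplings \<mu> \<nu>"
  shows "set_pmf \<pi> \<subseteq> set_pmf \<mu> \<times> set_pmf \<nu>"
  using assms by (force simp: couplings_def)

lemma coupling_cost_nonneg: "0 \<le> measure_pmf.expectation \<pi> (\<lambda>(x, y). mdist X x y)"
  by (rule integral_nonneg_AE) auto

lemma bdd_below_coupling_cost:
  "bdd_below ((\<lambda>\<pi>. measure_pmf.expectation \<pi> (\<lambda>(x, y). mdist X x y)) ` couplings \<mu> \<nu>)"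
  by (rule bdd_belowI2[where m = 0]) (rule coupling_cost_nonneg)

lemma wasserstein1_le:
  "\<pi> \<in> couplings \<mu> \<nu> \<Longrightarrow>
    wasserstein1 X \<mu> \<nu> \<le> measure_pmf.expectation \<pi> (\<lambda>(x, y). mdist X x y)"
  unfolding wasserstein1_def by (rule cINF_lower[OF bdd_below_coupling_cost])

lemma wasserstein1_nonneg: "0 \<le> wasserstein1 X \<mu> \<nu>"
  unfolding wasserstein1_def
  using pair_pmf_in_couplings by (intro cINF_greatest) (auto intro: coupling_cost_nonneg)

lemma wasserstein1_commute_le: "wasserstein1 X \<mu> \<nu> \<le> wasserstein1 X \<nu> \<mu>"
  unfolding wasserstein1_def[of X \<nu> \<mu>]
proof (rule cINF_greatest)
  show "couplings \<nu> \<mu> \<noteq> {}" using pair_pmf_in_couplings by blast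
  fix \<pi> assume \<pi>: "\<pi> \<in> couplings \<nu> \<mu>"
  have "map_pmf prod.swap \<pi> \<in> couplings \<mu> \<nu>"
    using \<pi> by (auto simp: couplings_def map_pmf_comp prod.swap_def)
  then have "wasserstein1 X \<mu> \<nu>
      \<le> measure_pmf.expectation (map_pmf prod.swap \<pi>) (\<lambda>(x, y). mdist X x y)"
    by (rule wasserstein1_le)
  also have "\<dots> = measure_pmf.expectation \<pi> (\<lambda>(x, y). mdist X x y)"
    by (simp add: case_prod_unfold prod.swap_def mdist_commute)
  finally show "wasserstein1 X \<mu> \<nu> \<le> measure_pmf.expectation \<pi> (\<lambda>(x, y). mdist X x y)" .
qed

lemma wasserstein1_commute: "wasserstein1 X \<mu> \<nu> = wasserstein1 X \<nu> \<mu>"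
  by (intro antisym wasserstein1_commute_le)

lemma glue_couplings:
  assumes "\<pi> \<in> couplings \<mu> \<nu>" "\<rho> \<in> couplings \<nu> \<kappa>"
  obtains \<tau> :: "(('a \<times> 'a) \<times> ('a \<times> 'a)) pmf"
  where "map_pmf fst \<tau> = \<pi>" "map_pmf snd \<tau> = \<rho>" "\<And>s t. (s, t) \<in> set_pmf \<tau> \<Longrightarrow> snd s = fst t"
proof -
  have "rel_pmf (\<lambda>s y. snd s = y) \<pi> (map_pmf snd \<pi>)"
    "rel_pmf (\<lambda>y t. y = fst t) (map_pmf fst \<rho>) \<rho>"
    by (simp_all add: pmf.rel_map pmf.rel_refl)
  then have "rel_pmf (\<lambda>s y. snd s = y) \<pi> \<nu>" "rel_pmf (\<lambda>y t. y = fst t) \<nu> \<rho>"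
    using assms by (simp_all add: couplings_def)
  then have "rel_pmf ((\<lambda>s y. snd s = y) OO (\<lambda>y t. y = fst t)) \<pi> \<rho>"
    by (auto simp: pmf.rel_compp)
  then show ?thesis
    by (elim rel_pmf.cases) (auto intro!: that)
qed

lemma wasserstein1_triangle:
  assumes "\<mu> \<in> thickening_space X \<delta>" "\<nu> \<in> thickening_space X \<delta>" "\<kappa> \<in> thickening_space X \<delta>"
  shows "wasserstein1 X \<mu> \<kappa> \<le> wasserstein1 X \<mu> \<nu> + wasserstein1 X \<nu> \<kappa>"
proof -
  let ?E = "\<lambda>\<pi>. measure_pmf.expectation \<pi> (\<lambda>(x, y). mdist X x y)"
  have key: "wasserstein1 X \<mu> \<kappa> \<le> ?E \<pi> + ?E \<rho>"
    if \<pi>: "\<pi> \<in> couplings \<mu> \<nu>" and \<rho>: "\<rho> \<in> couplings \<nu> \<kappa>" for \<pi> \<rho>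
  proof -
    obtain \<tau> where \<tau>: "map_pmf fst \<tau> = \<pi>" "map_pmf snd \<tau> = \<rho>"
      "\<And>s t. (s, t) \<in> set_pmf \<tau> \<Longrightarrow> snd s = fst t"
      using glue_couplings[OF \<pi> \<rho>] by blast
    have sub: "set_pmf \<tau> \<subseteq> set_pmf \<pi> \<times> set_pmf \<rho>"
      unfolding \<tau>(1,2)[symmetric] by force
    have fin: "finite (set_pmf \<tau>)"
    proof (rule finite_subset)
      show "set_pmf \<tau> \<subseteq> (set_pmf \<mu> \<times> set_pmf \<nu>) \<times> (set_pmf \<nu> \<times> set_pmf \<kappa>)"
        using sub set_pmf_coupling[OF \<pi>] set_pmf_coupling[OF \<rho>] by blast
    qed (use assms in \<open>auto simp: thickening_space_def\<close>)
    have "map_pmf (\<lambda>(s, t). (fst s, snd t)) \<tau> \<in> couplings \<mu> \<kappa>"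
      using \<pi> \<rho> unfolding couplings_def \<tau>(1,2)[symmetric]
      by (auto simp: map_pmf_comp case_prod_unfold)
    then have "wasserstein1 X \<mu> \<kappa> \<le> ?E (map_pmf (\<lambda>(s, t). (fst s, snd t)) \<tau>)"
      by (rule wasserstein1_le)
    also have "\<dots> = measure_pmf.expectation \<tau> (\<lambda>(s, t). mdist X (fst s) (snd t))"
      by (simp add: case_prod_unfold)
    also have "\<dots> \<le> measure_pmf.expectation \<tau>
        (\<lambda>(s, t). mdist X (fst s) (snd s) + mdist X (fst t) (snd t))"
    proof (rule integral_mono_AE)
      show "AE u in measure_pmf \<tau>. (case u of (s, t) \<Rightarrow> mdist X (fst s) (snd t))
          \<le> (case u of (s, t) \<Rightarrow> mdist X (fst s) (snd s) + mdist X (fst t) (snd t))"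
      proof (rule AE_pmfI, clarify)
        fix a b c e assume u: "((a, b), (c, e)) \<in> set_pmf \<tau>"
        have "b = c" using \<tau>(3)[OF u] by simp
        moreover have "a \<in> mspace X" "b \<in> mspace X" "e \<in> mspace X"
          using u sub set_pmf_coupling[OF \<pi>] set_pmf_coupling[OF \<rho>] assms
          by (auto simp: thickening_space_def)
        ultimately show "mdist X (fst (a, b)) (snd (c, e))
            \<le> mdist X (fst (a, b)) (snd (a, b)) + mdist X (fst (c, e)) (snd (c, e))"
          using mdist_triangle by auto
      qed
    qed (rule integrable_measure_pmf_finite[OF fin])+
    also have "\<dots> = measure_pmf.expectation \<tau> (\<lambda>u. mdist X (fst (fst u)) (snd (fst u)))
        + measure_pmf.expectation \<tau> (\<lambda>u. mdist X (fst (snd u)) (snd (snd u)))"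
      unfolding case_prod_unfold
      by (rule Bochner_Integration.integral_add) (rule integrable_measure_pmf_finite[OF fin])+
    also have "\<dots> = ?E \<pi> + ?E \<rho>"
      by (simp add: \<tau>(1,2)[symmetric] case_prod_unfold)
    finally show ?thesis .
  qed
  have ne: "couplings \<mu> \<nu> \<noteq> {}" "couplings \<nu> \<kappa> \<noteq> {}"
    using pair_pmf_in_couplings by blast+
  have "wasserstein1 X \<mu> \<kappa> - ?E \<rho> \<le> wasserstein1 X \<mu> \<nu>" if "\<rho> \<in> couplings \<nu> \<kappa>" for \<rho>
    unfolding wasserstein1_def[of X \<mu> \<nu>]
    using key[OF _ that] by (intro cINF_greatest[OF ne(1)]) (simp add: algebra_simps)
  then have "wasserstein1 X \<mu> \<kappa> - wasserstein1 X \<mu> \<nu> \<le> wasserstein1 X \<nu> \<kappa>"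
    unfolding wasserstein1_def[of X \<nu> \<kappa>]
    by (intro cINF_greatest[OF ne(2)]) (simp add: algebra_simps)
  then show ?thesis by simp
qed

lemma wasserstein1_eq_0_iff:
  assumes "\<mu> \<in> thickening_space X \<delta>" "\<nu> \<in> thickening_space X \<delta>"
  shows "wasserstein1 X \<mu> \<nu> = 0 \<longleftrightarrow> \<mu> = \<nu>"
proof
  let ?E = "\<lambda>\<pi>. measure_pmf.expectation \<pi> (\<lambda>(x, y). mdist X x y)"
  assume "\<mu> = \<nu>"
  moreover have "map_pmf (\<lambda>x. (x, x)) \<mu> \<in> couplings \<mu> \<mu>"
    by (simp add: couplings_def map_pmf_comp)
  then have "wasserstein1 X \<mu> \<mu> \<le> ?E (map_pmf (\<lambda>x. (x, x)) \<mu>)"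
    by (rule wasserstein1_le)
  moreover have "?E (map_pmf (\<lambda>x. (x, x)) \<mu>) = measure_pmf.expectation \<mu> (\<lambda>x. 0)"
    unfolding integral_map_pmf
    by (rule integral_cong_AE)
      (use assms in \<open>auto simp: AE_measure_pmf_iff thickening_space_def\<close>)
  ultimately show "wasserstein1 X \<mu> \<nu> = 0"
    using wasserstein1_nonneg[of X \<mu> \<nu>] by simp
next
  let ?E = "\<lambda>\<pi>. measure_pmf.expectation \<pi> (\<lambda>(x, y). mdist X x y)"
  assume W0: "wasserstein1 X \<mu> \<nu> = 0"
  let ?D = "insert 1 ((\<lambda>(x, y). mdist X x y) ` {(x, y) \<in> set_pmf \<mu> \<times> set_pmf \<nu>. x \<noteq> y})"
  define c where "c = Min ?D"
  have fin: "finite (set_pmf \<mu>)" "finite (set_pmf \<nu>)"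
    and sub: "set_pmf \<mu> \<subseteq> mspace X" "set_pmf \<nu> \<subseteq> mspace X"
    using assms by (auto simp: thickening_space_def)
  have finD: "finite ?D"
    by (intro finite.insertI finite_imageI finite_subset[OF _ finite_cartesian_product[OF fin]]) auto
  have "0 < t" if "t \<in> ?D" for t
    using that
  proof (elim insertE imageE)
    fix u assume u: "t = (case u of (x, y) \<Rightarrow> mdist X x y)"
      "u \<in> {(x, y) \<in> set_pmf \<mu> \<times> set_pmf \<nu>. x \<noteq> y}"
    obtain x y where xy: "u = (x, y)" by fastforce
    then have "mdist X x y \<noteq> 0"
      using u sub by (subst mdist_zero) auto
    then show "0 < t" using mdist_nonneg[of X x y] u xy by (simp add: less_le)
  qed simp
  then have c: "0 < c"
    unfolding c_def using finD by (subst Min_gr_iff) auto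
  have c_le: "c \<le> mdist X x y" if "x \<in> set_pmf \<mu>" "y \<in> set_pmf \<nu>" "x \<noteq> y" for x y
    unfolding c_def by (rule Min_le[OF finD]) (use that in auto)
  have key: "c * (pmf \<mu> a - pmf \<nu> a) \<le> ?E \<pi>" if \<pi>: "\<pi> \<in> couplings \<mu> \<nu>" for \<pi> a
  proof -
    have fin\<pi>: "finite (set_pmf \<pi>)"
      using set_pmf_coupling[OF \<pi>] fin by (meson finite_SigmaI finite_subset)
    have "pmf \<mu> a = measure_pmf.expectation \<pi> (\<lambda>u. indicator {a} (fst u))"
    proof -
      have "pmf \<mu> a = measure_pmf.expectation \<mu> (indicator {a})"
        by (simp add: measure_pmf_single)
      also have "\<dots> = measure_pmf.expectation \<pi> (\<lambda>u. indicator {a} (fst u))"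
        unfolding integral_map_pmf[of fst, symmetric] using \<pi> by (simp only: couplings_def mem_Collect_eq)
      finally show ?thesis .
    qed
    moreover have "pmf \<nu> a = measure_pmf.expectation \<pi> (\<lambda>u. indicator {a} (snd u))"
    proof -
      have "pmf \<nu> a = measure_pmf.expectation \<nu> (indicator {a})"
        by (simp add: measure_pmf_single)
      also have "\<dots> = measure_pmf.expectation \<pi> (\<lambda>u. indicator {a} (snd u))"
        unfolding integral_map_pmf[of snd, symmetric] using \<pi> by (simp only: couplings_def mem_Collect_eq)
      finally show ?thesis .
    qed
    ultimately have "c * (pmf \<mu> a - pmf \<nu> a) = measure_pmf.expectation \<pi>
        (\<lambda>u. c * (indicator {a} (fst u) - indicator {a} (snd u)))"
      by (simp add: integrable_measure_pmf_finite[OF fin\<pi>])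
    also have "\<dots> \<le> ?E \<pi>"
    proof (rule integral_mono_AE)
      show "AE u in measure_pmf \<pi>. c * (indicator {a} (fst u) - indicator {a} (snd u))
          \<le> (case u of (x, y) \<Rightarrow> mdist X x y)"
      proof (rule AE_pmfI, clarify)
        fix x y assume "(x, y) \<in> set_pmf \<pi>"
        then have "x \<in> set_pmf \<mu>" "y \<in> set_pmf \<nu>"
          using set_pmf_coupling[OF \<pi>] by auto
        then show "c * (indicator {a} (fst (x, y)) - indicator {a} (snd (x, y))) \<le> mdist X x y"
          using c_le[of x y] c mdist_nonneg[of X x y]
          by (cases "x = y") (auto simp: indicator_def order.trans[of "- c" 0])
      qed
    qed (rule integrable_measure_pmf_finite[OF fin\<pi>])+
    finally show ?thesis .
  qed
  have le: "pmf \<mu> a \<le> pmf \<nu> a" for a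
  proof -
    have "c * (pmf \<mu> a - pmf \<nu> a) \<le> wasserstein1 X \<mu> \<nu>"
      unfolding wasserstein1_def
      by (rule cINF_greatest) (use pair_pmf_in_couplings key in blast)+
    then show ?thesis using W0 c by (simp add: mult_le_0_iff)
  qed
  show "\<mu> = \<nu>"
  proof (rule pmf_eqI)
    fix a
    show "pmf \<mu> a = pmf \<nu> a"
    proof (rule ccontr)
      assume "pmf \<mu> a \<noteq> pmf \<nu> a"
      then have lt: "pmf \<mu> a < pmf \<nu> a" using le[of a] by simp
      then have a: "a \<in> set_pmf \<nu>" using pmf_nonneg[of \<mu> a] by (auto simp: set_pmf_iff)
      let ?S = "set_pmf \<mu> \<union> set_pmf \<nu>"
      have "(\<Sum>b\<in>?S. pmf \<mu> b) < (\<Sum>b\<in>?S. pmf \<nu> b)"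
        by (rule sum_strict_mono_ex1) (use fin le lt a in auto)
      moreover have "(\<Sum>b\<in>?S. pmf \<mu> b) = 1" "(\<Sum>b\<in>?S. pmf \<nu> b) = 1"
        using fin by (auto intro: sum_pmf_eq_1)
      ultimately show False by simp
    qed
  qed
qed

lemma Metric_space_thickening: "Metric_space (thickening_space X \<delta>) (wasserstein1 X)"
  by unfold_locales
    (auto intro: wasserstein1_nonneg wasserstein1_commute wasserstein1_triangle
      simp: wasserstein1_eq_0_iff)

lemma mspace_metric_thickening [simp]: "mspace (metric_thickening X \<delta>) = thickening_space X \<delta>"
  by (simp add: metric_thickening_def Metric_space.mspace_metric[OF Metric_space_thickening])

lemma mdist_metric_thickening [simp]: "mdist (metric_thickening X \<delta>) = wasserstein1 X"
  by (simp add: metric_thickening_def Metric_space.mdist_metric[OF Metric_space_thickening])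

lemma map_pmf_uminus_in_thickening:
  fixes \<mu> :: "'a::real_inner pmf"
  assumes "\<mu> \<in> thickening_space sphere_metric \<delta>"
  shows "map_pmf uminus \<mu> \<in> thickening_space sphere_metric \<delta>"
  using assms by (auto simp: thickening_space_def)

end

theory Submission
  imports Defs
begin

text \<open>Choose \<open>n + 1\<close> unit vectors \<open>v\<^sub>i\<close> whose lines realise the maximal separation
  \<open>\<epsilon> = p\<^sub>n\<^sub>+\<^sub>1\<close> of projective space. For \<open>i \<noteq> j\<close> both \<open>v\<^sub>j\<close> and \<open>- v\<^sub>j\<close> are at angle at
  least \<open>\<epsilon>\<close> from \<open>v\<^sub>i\<close>, hence both are at angle at most \<open>\<pi> - \<epsilon> \<le> \<delta>\<close> from it. So a set of the
  points \<open>\<plusminus> v\<^sub>i\<close> that contains no antipodal pair \<open>{v\<^sub>i, - v\<^sub>i}\<close> has diameter at most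
  \<open>\<delta>\<close>: the simplices of the boundary of the cross-polytope on the vertices \<open>\<plusminus> v\<^sub>i\<close> all map into
  the thickening. That boundary is an \<open>n\<close>-sphere, and in the coordinates of \<open>S\<^sup>n\<close> the resulting
  odd map is \<open>y \<mapsto> \<Sum>\<^sub>i (\<bar>y\<^sub>i\<bar> / \<parallel>y\<parallel>\<^sub>1) (sgn y\<^sub>i) v\<^sub>i\<close>.

  Two points need an argument. The supremum defining \<open>\<epsilon>\<close> must be attained, as \<open>\<delta> = \<pi> - \<epsilon>\<close> is
  allowed; this is compactness of the set of configurations of unit vectors
  (\<open>max_separation_proj_attained\<close>). And the map must be continuous for the Wasserstein metric;
  since all the measures live on the same finitely many points and their weights depend
  continuously on \<open>y\<close>, it suffices that the Wasserstein distance is controlled by the total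
  variation of the weights (\<open>wasserstein1_map_pmf_le\<close>).\<close>


section \<open>The Wasserstein distance and total variation\<close>

lemma pmf_embed_finite:
  fixes f :: "'b::finite \<Rightarrow> real"
  assumes "\<And>a. 0 \<le> f a" "(\<Sum>a\<in>UNIV. f a) = 1"
  shows "pmf (embed_pmf f) = f"
proof
  fix a
  show "pmf (embed_pmf f) a = f a"
    using assms
    by (intro pmf_embed_pmf) (simp_all add: nn_integral_count_space_finite)
qed

text \<open>The maximal coupling: the mass \<open>s a = min (p a) (q a)\<close> common to both measures stays in
  place, and the rest is coupled independently.\<close>

lemma maximal_coupling:
  fixes p q :: "'b::finite pmf"
  obtains \<pi> where "\<pi> \<in> couplings p q"
    "(\<Sum>(a, b)\<in>{(a, b). a \<noteq> b}. pmf \<pi> (a, b)) \<le> (\<Sum>a\<in>UNIV. \<bar>pmf p a - pmf q a\<bar>)"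
proof -
  define s where "s a = min (pmf p a) (pmf q a)" for a
  define m where "m = 1 - (\<Sum>a\<in>UNIV. s a)"
  define w where
    "w = (\<lambda>(a, b). (if a = b then s a else 0) + (pmf p a - s a) * (pmf q b - s b) / m)"
  have sp: "s a \<le> pmf p a" and sq: "s a \<le> pmf q a" and s0: "0 \<le> s a" for a
    by (auto simp: s_def)
  have tot: "(\<Sum>a\<in>UNIV. pmf p a) = 1" "(\<Sum>a\<in>UNIV. pmf q a) = 1"
    by (auto intro: sum_pmf_eq_1)
  have mp: "(\<Sum>a\<in>UNIV. pmf p a - s a) = m" and mq: "(\<Sum>a\<in>UNIV. pmf q a - s a) = m"
    by (simp_all add: sum_subtractf tot m_def)
  have m0: "0 \<le> m"
    unfolding mp[symmetric] by (intro sum_nonneg) (simp add: sp)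
  \<comment> \<open>If \<open>m = 0\<close>, the two measures agree and no mass is left to move, so the convention
    \<open>0 / 0 = 0\<close> gives the right quotient in \<open>w\<close>.\<close>
  have zero: "pmf p a - s a = 0" "pmf q a - s a = 0" if "m = 0" for a
    using mp mq that sp sq by (auto simp: sum_nonneg_eq_0_iff)
  have w0: "0 \<le> w u" for u
    using sp sq s0 m0 by (cases u) (auto simp: w_def)
  have row: "(\<Sum>b\<in>UNIV. w (a, b)) = pmf p a" for a
  proof -
    have "(\<Sum>b\<in>UNIV. w (a, b)) = s a + (pmf p a - s a) * m / m"
      by (simp add: w_def sum.distrib mq flip: sum_distrib_left sum_divide_distrib)
    then show ?thesis using zero(1)[of a] by (cases "m = 0") auto
  qed
  have col: "(\<Sum>a\<in>UNIV. w (a, b)) = pmf q b" for b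
  proof -
    have "(\<Sum>a\<in>UNIV. w (a, b)) = s b + m * (pmf q b - s b) / m"
      by (simp add: w_def sum.distrib mp flip: sum_distrib_right sum_divide_distrib)
    then show ?thesis using zero(2)[of b] by (cases "m = 0") auto
  qed
  have "(\<Sum>u\<in>UNIV. w u) = (\<Sum>a\<in>UNIV. \<Sum>b\<in>UNIV. w (a, b))"
    by (simp add: sum.cartesian_product flip: UNIV_Times_UNIV)
  then have pmf_w: "pmf (embed_pmf w) = w"
    by (intro pmf_embed_finite w0) (simp add: row tot)
  have "map_pmf fst (embed_pmf w) = p"
  proof (rule pmf_eqI)
    fix a :: 'b
    have "fst -` {a} = Pair a ` (UNIV :: 'b set)" by auto
    then show "pmf (map_pmf fst (embed_pmf w)) a = pmf p a"
      by (simp add: pmf_map measure_measure_pmf_finite pmf_w sum.reindex inj_on_def row)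
  qed
  moreover have "map_pmf snd (embed_pmf w) = q"
  proof (rule pmf_eqI)
    fix b :: 'b
    have "snd -` {b} = (\<lambda>a. (a, b)) ` (UNIV :: 'b set)" by auto
    then show "pmf (map_pmf snd (embed_pmf w)) b = pmf q b"
      by (simp add: pmf_map measure_measure_pmf_finite pmf_w sum.reindex inj_on_def col)
  qed
  ultimately have "embed_pmf w \<in> couplings p q"
    by (simp add: couplings_def)
  moreover have "(\<Sum>(a, b)\<in>{(a, b). a \<noteq> b}. pmf (embed_pmf w) (a, b))
      \<le> (\<Sum>a\<in>UNIV. \<bar>pmf p a - pmf q a\<bar>)"
  proof -
    have "(\<Sum>(a, b)\<in>{(a, b). a \<noteq> b}. pmf (embed_pmf w) (a, b))
        = (\<Sum>(a, b)\<in>{(a, b). a \<noteq> b}. (pmf p a - s a) * (pmf q b - s b) / m)"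
      unfolding pmf_w by (intro sum.cong) (auto simp: w_def)
    also have "\<dots> \<le> (\<Sum>(a, b)\<in>UNIV. (pmf p a - s a) * (pmf q b - s b) / m)"
      using sp sq m0 by (intro sum_mono2) auto
    also have "\<dots> = (\<Sum>a\<in>UNIV. \<Sum>b\<in>UNIV. (pmf p a - s a) * (pmf q b - s b) / m)"
      by (simp add: sum.cartesian_product flip: UNIV_Times_UNIV)
    also have "\<dots> = m * m / m"
      by (simp only: mp mq flip: sum_divide_distrib sum_distrib_left sum_distrib_right)
    also have "\<dots> = (\<Sum>a\<in>UNIV. pmf p a - s a)"
      unfolding mp by simp
    also have "\<dots> \<le> (\<Sum>a\<in>UNIV. \<bar>pmf p a - pmf q a\<bar>)"
      by (intro sum_mono) (auto simp: s_def)
    finally show ?thesis .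
  qed
  ultimately show ?thesis by (rule that)
qed

text \<open>In the maximal coupling only the mass off the diagonal is transported, each unit of it
  over a distance at most \<open>D\<close>.\<close>

lemma wasserstein1_map_pmf_le:
  fixes p q :: "'b::finite pmf"
  assumes g: "\<And>a. g a \<in> mspace X" and D: "\<And>a b. mdist X (g a) (g b) \<le> D"
  shows "wasserstein1 X (map_pmf g p) (map_pmf g q) \<le> D * (\<Sum>a\<in>UNIV. \<bar>pmf p a - pmf q a\<bar>)"
proof -
  obtain \<pi> where \<pi>: "\<pi> \<in> couplings p q"
    and le: "(\<Sum>(a, b)\<in>{(a, b). a \<noteq> b}. pmf \<pi> (a, b)) \<le> (\<Sum>a\<in>UNIV. \<bar>pmf p a - pmf q a\<bar>)"
    by (rule maximal_coupling)
  have D0: "0 \<le> D"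
    by (rule order_trans[OF mdist_nonneg D])
  have "map_pmf (map_prod g g) \<pi> \<in> couplings (map_pmf g p) (map_pmf g q)"
  proof -
    have "map_pmf fst (map_pmf (map_prod g g) \<pi>) = map_pmf g (map_pmf fst \<pi>)"
      "map_pmf snd (map_pmf (map_prod g g) \<pi>) = map_pmf g (map_pmf snd \<pi>)"
      by (simp_all add: map_pmf_comp)
    then show ?thesis using \<pi> by (simp add: couplings_def)
  qed
  then have "wasserstein1 X (map_pmf g p) (map_pmf g q)
      \<le> measure_pmf.expectation (map_pmf (map_prod g g) \<pi>) (\<lambda>(x, y). mdist X x y)"
    by (rule wasserstein1_le)
  also have "\<dots> = (\<Sum>(a, b)\<in>UNIV. mdist X (g a) (g b) * pmf \<pi> (a, b))"
    by (simp add: integral_measure_pmf_real[of UNIV] case_prod_unfold)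
  also have "\<dots> = (\<Sum>(a, b)\<in>{(a, b). a \<noteq> b}. mdist X (g a) (g b) * pmf \<pi> (a, b))"
    by (intro sum.mono_neutral_right) (auto simp: g mdist_zero)
  also have "\<dots> \<le> (\<Sum>(a, b)\<in>{(a, b). a \<noteq> b}. D * pmf \<pi> (a, b))"
    by (intro sum_mono) (auto intro!: mult_right_mono D)
  also have "\<dots> = D * (\<Sum>(a, b)\<in>{(a, b). a \<noteq> b}. pmf \<pi> (a, b))"
    by (simp add: sum_distrib_left case_prod_unfold)
  also have "\<dots> \<le> D * (\<Sum>a\<in>UNIV. \<bar>pmf p a - pmf q a\<bar>)"
    by (intro mult_left_mono le D0)
  finally show ?thesis .
qed


section \<open>Optimally separated lines\<close>

lemma continuous_on_Max:
  fixes f :: "'i \<Rightarrow> 'a::topological_space \<Rightarrow> real"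
  assumes "finite I" "I \<noteq> {}" "\<And>i. i \<in> I \<Longrightarrow> continuous_on S (f i)"
  shows "continuous_on S (\<lambda>x. MAX i\<in>I. f i x)"
  using assms
proof (induction rule: finite_ne_induct)
  case (insert i I)
  have "(MAX j\<in>insert i I. f j x) = max (f i x) (MAX j\<in>I. f j x)" for x
    using insert.hyps by simp
  with insert show ?case by (auto intro: continuous_on_max)
qed simp

text \<open>A configuration of positive separation: on a great circle through two orthonormal vectors,
  angles below \<open>1 < \<pi> / 2\<close> are also angles between lines. It makes the set in the definition of
  \<^const>\<open>max_separation\<close> nonempty, without which the supremum would say nothing.\<close>

lemma separated_lines_exist:
  assumes "2 \<le> DIM('a::euclidean_space)" "0 < m"
  obtains x :: "nat \<Rightarrow> 'a::euclidean_space" where "\<And>i. x i \<in> sphere 0 1"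
    "\<And>i j. i < m \<Longrightarrow> j < m \<Longrightarrow> i \<noteq> j \<Longrightarrow> 1 / m \<le> arccos \<bar>x i \<bullet> x j\<bar>"
proof -
  obtain b c :: 'a where bc: "b \<in> Basis" "c \<in> Basis" "b \<noteq> c"
    using assms(1) by (metis card_le_Suc0_iff_eq finite_Basis not_less_eq_eq numeral_2_eq_2)
  define x where "x i = cos (real i / m) *\<^sub>R b + sin (real i / m) *\<^sub>R c" for i
  have ip: "x i \<bullet> x j = cos (real i / m - real j / m)" for i j
    using bc by (simp add: x_def inner_add_left inner_add_right inner_Basis cos_diff)
  show ?thesis
  proof
    show "x i \<in> sphere 0 1" for i
      using ip[of i i] by (simp add: norm_eq_sqrt_inner)
  next
    fix i j :: nat assume ij: "i < m" "j < m" "i \<noteq> j"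
    define t where "t = \<bar>real i / m - real j / m\<bar>"
    have t: "t = \<bar>real i - real j\<bar> / m"
      using assms(2) by (simp add: t_def flip: diff_divide_distrib)
    have "1 \<le> \<bar>real i - real j\<bar>" "\<bar>real i - real j\<bar> < m"
      using ij by linarith+
    then have lo: "1 / m \<le> t" and hi: "t < 1"
      unfolding t using assms(2) by (simp_all add: divide_right_mono)
    have t0: "0 \<le> t" by (simp add: t_def)
    have pi2: "t < pi / 2" using hi pi_ge_two by linarith
    have "x i \<bullet> x j = cos t"
      by (simp add: ip t_def)
    moreover have "0 \<le> cos t"
      using t0 pi2 by (intro cos_ge_zero) auto
    ultimately have "arccos \<bar>x i \<bullet> x j\<bar> = t"
      using t0 pi2 by (simp add: arccos_cos)
    then show "1 / m \<le> arccos \<bar>x i \<bullet> x j\<bar>" using lo by simp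
  qed
qed

text \<open>Configurations indexed by a finite type form a compact subset of a Euclidean space, on which
  the largest \<open>\<bar>v i \<bullet> v j\<bar>\<close> is continuous, and minimising it maximises the smallest angle.\<close>

lemma max_separation_proj_attained:
  assumes dim: "2 \<le> DIM('a::euclidean_space)" and card: "2 \<le> CARD('l::finite)"
  obtains v :: "'a::euclidean_space ^ 'l::finite" where "\<And>i. v $ i \<in> sphere 0 1"
    "\<And>i j. i \<noteq> j \<Longrightarrow>
      max_separation CARD('l::finite) (proj_metric :: 'a::euclidean_space set metric)
        \<le> arccos \<bar>v $ i \<bullet> v $ j\<bar>"
proof -
  define S where "S = {v :: 'a ^ 'l. \<forall>i. v $ i \<in> sphere 0 1}"
  define P :: "('l \<times> 'l) set" where "P = {(i, j). i \<noteq> j}"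
  define c where "c v = (MAX p\<in>P. \<bar>v $ fst p \<bullet> v $ snd p\<bar>)" for v :: "'a ^ 'l"
  have P: "finite P" "P \<noteq> {}"
  proof -
    obtain i j :: 'l where "i \<noteq> j"
      using card by (metis card_le_Suc0_iff_eq finite not_less_eq_eq numeral_2_eq_2)
    then show "P \<noteq> {}" by (auto simp: P_def)
  qed simp
  have c_ge: "\<bar>v $ i \<bullet> v $ j\<bar> \<le> c v" if "i \<noteq> j" for v i j
    unfolding c_def using P that by (intro Max_ge) (auto simp: P_def image_iff)
  have c_attained: "\<exists>i j. i \<noteq> j \<and> c v = \<bar>v $ i \<bullet> v $ j\<bar>" for v
  proof -
    have "c v \<in> (\<lambda>p. \<bar>v $ fst p \<bullet> v $ snd p\<bar>) ` P"
      unfolding c_def using P by (intro Max_in) auto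
    then obtain p where "p \<in> P" "c v = \<bar>v $ fst p \<bullet> v $ snd p\<bar>" by blast
    moreover from this have "fst p \<noteq> snd p" by (auto simp: P_def)
    ultimately show ?thesis by blast
  qed
  have c_le1: "\<bar>c v\<bar> \<le> 1" if "v \<in> S" for v
    using c_attained[of v] that abs_inner_sphere_le_1 unfolding S_def by fastforce
  have "compact S"
    unfolding compact_eq_bounded_closed
  proof
    have "norm v \<le> (\<Sum>i\<in>(UNIV :: 'l set). 1)" if "v \<in> S" for v
      unfolding norm_vec_def using that
      by (intro order_trans[OF L2_set_le_sum] sum_mono) (auto simp: S_def)
    then show "bounded S" by (auto simp: bounded_iff)
    have "S = (\<Inter>i. (\<lambda>v. v $ i) -` sphere 0 1)" by (auto simp: S_def)
    then show "closed S"
      by (auto intro!: closed_INT closed_vimage continuous_intros)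
  qed
  moreover have "S \<noteq> {}"
  proof -
    obtain b :: 'a where "b \<in> Basis" using nonempty_Basis by blast
    then have "(\<chi> i. b) \<in> S" by (auto simp: S_def)
    then show ?thesis by blast
  qed
  moreover have "continuous_on S c"
    unfolding c_def by (intro continuous_on_Max P continuous_intros)
  ultimately obtain v where v: "v \<in> S" "\<And>u. u \<in> S \<Longrightarrow> c v \<le> c u"
    by (metis continuous_attains_inf)
  have "max_separation CARD('l) (proj_metric :: 'a set metric) \<le> arccos (c v)"
    unfolding max_separation_def
  proof (rule cSup_least, goal_cases)
    case 1
    obtain x :: "nat \<Rightarrow> 'a" where x: "\<And>i. x i \<in> sphere 0 1"
      "\<And>i j. i < CARD('l) \<Longrightarrow> j < CARD('l) \<Longrightarrow> i \<noteq> j \<Longrightarrow> 1 / CARD('l) \<le> arccos \<bar>x i \<bullet> x j\<bar>"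
      using separated_lines_exist[OF dim, of "CARD('l)"] by auto
    then have "1 / CARD('l) \<le> proj_dist {x i, - x i} {x j, - x j}"
      if "i < CARD('l)" "j < CARD('l)" "i \<noteq> j" for i j
      using that by (subst proj_dist_eq_angle) auto
    moreover have "{x i, - x i} \<in> proj_space" for i
      using x(1) by (auto simp: proj_space_eq)
    moreover have "0 < 1 / CARD('l)" by simp
    ultimately show ?case
      unfolding mspace_proj_metric mdist_proj_metric
      by (intro ex_in_conv[THEN iffD1] exI[of _ "1 / CARD('l)"] CollectI conjI
          exI[of _ "\<lambda>i. {x i, - x i}"]) auto
  next
    case (2 \<epsilon>)
    then obtain x :: "nat \<Rightarrow> 'a set" where x: "\<And>i. i < CARD('l) \<Longrightarrow> x i \<in> proj_space"
      "\<And>i j. i < CARD('l) \<Longrightarrow> j < CARD('l) \<Longrightarrow> i \<noteq> j \<Longrightarrow> \<epsilon> \<le> proj_dist (x i) (x j)"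
      by auto
    obtain h where h: "bij_betw h (UNIV :: 'l set) {0..<CARD('l)}"
      using ex_bij_betw_finite_nat[of "UNIV :: 'l set"] by auto
    then have h_less: "h i < CARD('l)" for i
      using bij_betwE by fastforce
    have "\<exists>u. u \<in> sphere 0 1 \<and> x (h i) = {u, - u}" for i
      using x(1)[OF h_less] by (metis proj_spaceE)
    then obtain w where w: "\<And>i. w i \<in> sphere 0 1" "\<And>i. x (h i) = {w i, - w i}"
      by metis
    define u where "u = (\<chi> i. w i)"
    have uS: "u \<in> S" using w by (simp add: S_def u_def)
    obtain i j where ij: "i \<noteq> j" "c u = \<bar>u $ i \<bullet> u $ j\<bar>"
      using c_attained by blast
    have "h i \<noteq> h j" using h ij(1) by (auto simp: bij_betw_def inj_on_def)
    then have "\<epsilon> \<le> proj_dist (x (h i)) (x (h j))"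
      using x(2) h_less by blast
    also have "\<dots> = arccos (c u)"
      unfolding ij(2) by (simp only: w(2) proj_dist_eq_angle[OF w(1) w(1)] u_def vec_lambda_beta)
    also have "\<dots> \<le> arccos (c v)"
      using v uS c_le1 by (intro arccos_le_arccos) (auto simp: abs_le_iff minus_le_iff)
    finally show ?case .
  qed
  also have "arccos (c v) \<le> arccos \<bar>v $ i \<bullet> v $ j\<bar>" if "i \<noteq> j" for i j
    using c_ge[OF that, of v] c_le1[OF v(1)] by (intro arccos_le_arccos) auto
  finally show ?thesis using v(1) by (intro that) (auto simp: S_def)
qed


section \<open>Cross-polytope coordinates\<close>

text \<open>The vertex \<open>(i, True)\<close> of the cross-polytope stands for \<open>e\<^sub>i\<close> and \<open>(i, False)\<close> for \<open>- e\<^sub>i\<close>; these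
  are the barycentric coordinates of \<open>y / \<parallel>y\<parallel>\<^sub>1\<close> in its boundary. Splitting the coordinates into
  positive and negative parts, rather than moving the vertices with the sign of \<open>y\<^sub>i\<close>, makes
  the weights continuous while the vertices stay fixed.\<close>

definition crosspolytope_weight :: "real ^ 'l \<Rightarrow> 'l::finite \<times> bool \<Rightarrow> real" where
  "crosspolytope_weight y = (\<lambda>(i, s).
     (if s then max (y $ i) 0 else max (- (y $ i)) 0) / (\<Sum>j\<in>UNIV. \<bar>y $ j\<bar>))"

definition crosspolytope_pmf :: "real ^ 'l \<Rightarrow> ('l::finite \<times> bool) pmf" where
  "crosspolytope_pmf y = embed_pmf (crosspolytope_weight y)"

lemma sum_abs_pos:
  fixes y :: "real ^ 'l::finite"
  assumes "y \<noteq> 0"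
  shows "0 < (\<Sum>j\<in>UNIV. \<bar>y $ j\<bar>)"
proof -
  obtain i where "y $ i \<noteq> 0" using assms by (auto simp: vec_eq_iff)
  then show ?thesis by (intro sum_pos2[where i = i]) auto
qed

lemma pmf_crosspolytope:
  assumes "y \<noteq> 0"
  shows "pmf (crosspolytope_pmf y) = crosspolytope_weight y"
  unfolding crosspolytope_pmf_def
proof (rule pmf_embed_finite)
  show "0 \<le> crosspolytope_weight y u" for u
    by (cases u) (auto simp: crosspolytope_weight_def intro!: divide_nonneg_nonneg sum_nonneg)
  have "(\<Sum>u\<in>UNIV. crosspolytope_weight y u)
      = (\<Sum>i\<in>UNIV. \<Sum>s\<in>UNIV. crosspolytope_weight y (i, s))"
    by (simp add: sum.cartesian_product flip: UNIV_Times_UNIV)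
  also have "\<dots> = (\<Sum>i\<in>UNIV. \<bar>y $ i\<bar> / (\<Sum>j\<in>UNIV. \<bar>y $ j\<bar>))"
    by (intro sum.cong refl) (auto simp: crosspolytope_weight_def UNIV_bool max_def abs_if)
  also have "\<dots> = 1"
    using sum_abs_pos[OF assms] by (simp flip: sum_divide_distrib)
  finally show "(\<Sum>u\<in>UNIV. crosspolytope_weight y u) = 1" .
qed

text \<open>A coordinate cannot be both positive and negative, so the face carrying \<open>y / \<parallel>y\<parallel>\<^sub>1\<close>
  contains no two opposite vertices. This keeps pairs at distance \<open>\<pi>\<close> out of the supports of the
  measures below.\<close>

lemma crosspolytope_no_opposite:
  assumes "y \<noteq> 0" "(i, s) \<in> set_pmf (crosspolytope_pmf y)" "(i, t) \<in> set_pmf (crosspolytope_pmf y)"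
  shows "s = t"
  using assms
  by (cases s; cases t) (auto simp: set_pmf_iff pmf_crosspolytope crosspolytope_weight_def max_def
      split: if_splits)

lemma crosspolytope_pmf_uminus:
  assumes "y \<noteq> 0"
  shows "crosspolytope_pmf (- y) = map_pmf (apsnd Not) (crosspolytope_pmf y)"
proof (rule pmf_eqI)
  fix u :: "'a \<times> bool"
  have inj: "inj (apsnd Not :: 'a \<times> bool \<Rightarrow> _)"
    by (auto simp: inj_def)
  have "pmf (map_pmf (apsnd Not) (crosspolytope_pmf y)) u
      = pmf (map_pmf (apsnd Not) (crosspolytope_pmf y)) (apsnd Not (apsnd Not u))"
    by (cases u) simp
  also have "\<dots> = pmf (crosspolytope_pmf y) (apsnd Not u)"
    by (rule pmf_map_inj'[OF inj])
  also have "\<dots> = pmf (crosspolytope_pmf (- y)) u"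
    using assms by (cases u) (auto simp: pmf_crosspolytope crosspolytope_weight_def)
  finally show "pmf (crosspolytope_pmf (- y)) u
      = pmf (map_pmf (apsnd Not) (crosspolytope_pmf y)) u" ..
qed

lemma continuous_on_crosspolytope_weight:
  fixes u :: "'l::finite \<times> bool"
  shows "continuous_on (- {0}) (\<lambda>y. crosspolytope_weight y u)"
proof (cases u)
  case (Pair i s)
  have "\<forall>y\<in>- {0 :: real ^ 'l}. (\<Sum>j\<in>UNIV. \<bar>y $ j\<bar>) \<noteq> 0"
  proof
    fix y :: "real ^ 'l"
    assume "y \<in> - {0}"
    then show "(\<Sum>j\<in>UNIV. \<bar>y $ j\<bar>) \<noteq> 0"
      using sum_abs_pos[of y] by simp
  qed
  then show ?thesis
    unfolding Pair crosspolytope_weight_def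
    by (cases s) (auto intro!: continuous_intros continuous_on_max)
qed


section \<open>The odd map\<close>

lemma sphere_dist_le_pi: "sphere_dist x y \<le> pi"
  using abs_inner_sphere_le_1[of x y]
  by (auto simp: sphere_dist_def abs_le_iff minus_le_iff intro: arccos_ubound)

lemma continuous_map_crosspolytope:
  fixes g :: "'l::finite \<times> bool \<Rightarrow> 'a::real_inner"
  assumes g: "\<And>a. g a \<in> sphere 0 1"
    and thick: "\<And>y. y \<in> sphere 0 1 \<Longrightarrow>
      map_pmf g (crosspolytope_pmf y) \<in> thickening_space sphere_metric \<delta>"
  shows "continuous_map (mtopology_of sphere_metric) (mtopology_of (metric_thickening sphere_metric \<delta>))
    (\<lambda>y. map_pmf g (crosspolytope_pmf y))"
proof -
  let ?f = "\<lambda>y. map_pmf g (crosspolytope_pmf y)"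
  interpret T: Metric_space "thickening_space (sphere_metric :: 'a metric) \<delta>" "wasserstein1 sphere_metric"
    by (rule Metric_space_thickening)
  have "continuous_map (top_of_set (sphere 0 1)) T.mtopology ?f"
    unfolding T.continuous_map_to_metric
  proof (intro ballI allI impI)
    fix y :: "real ^ 'l" and e :: real
    assume y: "y \<in> topspace (top_of_set (sphere 0 1))" and e: "0 < e"
    define F where "F z = pi * (\<Sum>a\<in>UNIV. \<bar>crosspolytope_weight y a - crosspolytope_weight z a\<bar>)" for z
    have "continuous_on (sphere 0 1) (\<lambda>z :: real ^ 'l. crosspolytope_weight z a)" for a
      by (rule continuous_on_subset[OF continuous_on_crosspolytope_weight]) auto
    then have "continuous_on (sphere 0 1) F"
      unfolding F_def by (intro continuous_intros)
    then have "openin (top_of_set (sphere 0 1)) (sphere 0 1 \<inter> F -` {..<e})"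
      by (rule continuous_openin_preimage_gen) simp
    moreover have "y \<in> sphere 0 1 \<inter> F -` {..<e}"
      using y e by (simp add: F_def)
    moreover have "?f z \<in> T.mball (?f y) e" if z: "z \<in> sphere 0 1 \<inter> F -` {..<e}" for z
    proof -
      have "y \<noteq> 0" "z \<noteq> 0" using y z by auto
      have "wasserstein1 sphere_metric (?f y) (?f z) \<le>
          pi * (\<Sum>a\<in>UNIV. \<bar>pmf (crosspolytope_pmf y) a - pmf (crosspolytope_pmf z) a\<bar>)"
        using g by (intro wasserstein1_map_pmf_le) (simp_all add: sphere_dist_le_pi)
      also have "\<dots> = F z"
        by (simp add: F_def pmf_crosspolytope \<open>y \<noteq> 0\<close> \<open>z \<noteq> 0\<close>)
      finally show ?thesis using y z thick by auto
    qed
    ultimately show "\<exists>U. openin (top_of_set (sphere 0 1)) U \<and> y \<in> U \<and> (\<forall>z\<in>U. ?f z \<in> T.mball (?f y) e)"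
      by blast
  qed
  then show ?thesis
    unfolding mtopology_of_sphere_metric by (simp add: mtopology_of_def)
qed

theorem theorem2:
  fixes d n :: nat and \<delta> :: real
  assumes "d \<ge> 1" and "n \<ge> 1"
    and "CARD('k::finite) = d + 1" and "CARD('l::finite) = n + 1"
    and "\<delta> \<ge> pi - max_separation (n + 1) (proj_metric :: (real ^ 'k) set metric)"
  shows "\<exists>f :: real ^ 'l \<Rightarrow> (real ^ 'k) pmf.
    continuous_map (mtopology_of sphere_metric) (mtopology_of (metric_thickening sphere_metric \<delta>)) f \<and>
    (\<forall>x \<in> sphere 0 1. f (- x) = map_pmf uminus (f x))"
proof -
  have "2 \<le> DIM(real ^ 'k)" "2 \<le> CARD('l)"
    using assms by simp_all
  then obtain v :: "(real ^ 'k) ^ 'l" where v: "\<And>i. v $ i \<in> sphere 0 1"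
    and "\<And>i j. i \<noteq> j \<Longrightarrow>
      max_separation CARD('l) (proj_metric :: (real ^ 'k) set metric) \<le> arccos \<bar>v $ i \<bullet> v $ j\<bar>"
    by (rule max_separation_proj_attained) blast
  then have sep: "pi - \<delta> \<le> arccos \<bar>v $ i \<bullet> v $ j\<bar>" if "i \<noteq> j" for i j
    using that assms(4,5) by (metis diff_le_eq add.commute order_trans)
  define g where "g = (\<lambda>(i, s). if s then v $ i else - (v $ i))"
  have g: "g a \<in> sphere 0 1" for a
    using v by (cases a) (simp add: g_def)
  have g_dist: "sphere_dist (g (i, s)) (g (j, t)) \<le> \<delta>" if "i \<noteq> j" for i j s t
  proof -
    have b: "\<bar>v $ i \<bullet> v $ j\<bar> \<le> 1"
      using abs_inner_sphere_le_1 v by blast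
    have "g (i, s) \<bullet> g (j, t) = v $ i \<bullet> v $ j \<or> g (i, s) \<bullet> g (j, t) = - (v $ i \<bullet> v $ j)"
      by (auto simp: g_def)
    then have "sphere_dist (g (i, s)) (g (j, t)) \<le> arccos (- \<bar>v $ i \<bullet> v $ j\<bar>)"
      using g b by (auto simp: sphere_dist_def intro!: arccos_le_arccos)
    also have "\<dots> = pi - arccos \<bar>v $ i \<bullet> v $ j\<bar>"
      using b by (intro arccos_minus) auto
    finally show ?thesis using sep[OF that] by linarith
  qed
  have "0 \<le> \<delta>"
  proof -
    obtain i j :: 'l where "i \<noteq> j"
      using \<open>2 \<le> CARD('l)\<close>
      by (metis card_le_Suc0_iff_eq finite not_less_eq_eq numeral_2_eq_2)
    then show ?thesis using g_dist sphere.nonneg order_trans by blast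
  qed
  have thick: "map_pmf g (crosspolytope_pmf y) \<in> thickening_space sphere_metric \<delta>"
    if y: "y \<in> sphere 0 1" for y
  proof -
    have "sphere_dist (g a) (g b) \<le> \<delta>"
      if ab: "a \<in> set_pmf (crosspolytope_pmf y)" "b \<in> set_pmf (crosspolytope_pmf y)" for a b
    proof (cases "a = b")
      case True
      then show ?thesis using \<open>0 \<le> \<delta>\<close> g by simp
    next
      case False
      have "y \<noteq> 0" using y by auto
      obtain i s j t where [simp]: "a = (i, s)" "b = (j, t)" by fastforce
      from False have "i \<noteq> j"
        using crosspolytope_no_opposite[OF \<open>y \<noteq> 0\<close>] ab by auto
      then show ?thesis using g_dist by simp
    qed
    then show ?thesis using g by (auto simp: thickening_space_def)
  qed
  have "map_pmf g (crosspolytope_pmf (- y)) = map_pmf uminus (map_pmf g (crosspolytope_pmf y))"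
    if "y \<in> sphere 0 1" for y
  proof -
    have "y \<noteq> 0" using that by auto
    have "g \<circ> apsnd Not = uminus \<circ> g" by (auto simp: g_def)
    then show ?thesis
      by (simp add: crosspolytope_pmf_uminus[OF \<open>y \<noteq> 0\<close>] pmf.map_comp)
  qed
  then show ?thesis
    using continuous_map_crosspolytope[of g, OF g thick]
    by (intro exI[of _ "\<lambda>y. map_pmf g (crosspolytope_pmf y)"]) simp
qed

end
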